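(* Let $K$ be a field, $S=K[x_1,\ldots,x_n]$, and let $I\subset S$ be a monomial ideal with the non-pure dual exchange property. Then $I$ has linear quotients.
   Context: For a monomial ideal $I\subset S=K[x_1,\ldots,x_n]$, $G(I)$ denotes its unique minimal set of monomial generators. For a monomial $u$, $\deg_{x_i}(u)$ denotes the exponent of $x_i$ in $u$, and $\deg(u)$ its total degree. Non-pure dual exchange property: a monomial ideal $I$ satisfies the non-pure dual exchange property if, for all $u,v\in G(I)$ with $\deg(u)\leq \deg(v)$ and for all $i$ such that $\deg_{x_i}(v)<\deg_{x_i}(u)$, there exists $j$ such that $\deg_{x_j}(v)>\deg_{x_j}(u)$ and $x_i(v/x_j)\in I$. Linear quotients: a monomial ideal $I\subset S$ has linear quotients if there exists an ordering $u_1,\ldots,u_m$ of its minimal monomial generators $G(I)$ such that for each $i=2,\ldots,m$ the colon ideal $(u_1,\ldots,u_{i-1}):u_i$ is generated by a subset of the variables $x_1,\ldots,x_n$. *)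

theory Defs
  imports Complex_Main "HOL-Library.Poly_Mapping"
begin

text \<open>
  The polynomial ring \<open>K[x\<^sub>1,\<dots>,x\<^sub>n]\<close> is the ring of finitely supported functions from exponent
  vectors to \<open>K\<close>; the variables are indexed by an arbitrary finite type \<open>'n\<close> with \<open>n = CARD('n)\<close>
  elements. A monomial \<open>u\<close> is handled through its exponent vector, so \<open>deg\<^bsub>x\<^sub>i\<^esub>(u)\<close> is
  \<open>Poly_Mapping.lookup u i\<close>, and \<open>monom u\<close> is the corresponding element of the ring.
\<close>

type_synonym 'n exponents = "'n \<Rightarrow>\<^sub>0 nat"
type_synonym ('n, 'k) mpoly = "'n exponents \<Rightarrow>\<^sub>0 'k"

definition monom :: "'n exponents \<Rightarrow> ('n, 'k::field) mpoly" where
  "monom u = Poly_Mapping.single u 1"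

definition var :: "'n \<Rightarrow> ('n, 'k::field) mpoly" where
  "var i = monom (Poly_Mapping.single i 1)"

definition total_deg :: "'n::finite exponents \<Rightarrow> nat" where
  "total_deg u = (\<Sum>i\<in>UNIV. Poly_Mapping.lookup u i)"

text \<open>
  Ideals of a commutative ring are its submodules over itself: \<open>ideal.subspace I\<close> says that \<open>I\<close> is
  an ideal and \<open>ideal.span B\<close> is the ideal generated by \<open>B\<close>.
\<close>

global_interpretation ideal: module "(*) :: 'a::comm_ring_1 \<Rightarrow> 'a \<Rightarrow> 'a"
  by standard (simp_all add: algebra_simps)

definition colon_ideal :: "'a::comm_ring_1 set \<Rightarrow> 'a \<Rightarrow> 'a set" where
  "colon_ideal J f = {g. g * f \<in> J}"

definition monomial_ideal :: "('n, 'k::field) mpoly set \<Rightarrow> bool" where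
  "monomial_ideal I \<longleftrightarrow> (\<exists>M. I = ideal.span (monom ` M))"

definition is_min_mono_gens :: "'n exponents set \<Rightarrow> ('n, 'k::field) mpoly set \<Rightarrow> bool" where
  "is_min_mono_gens M I \<longleftrightarrow>
     ideal.span (monom ` M) = I \<and> (\<forall>N. N \<subset> M \<longrightarrow> ideal.span (monom ` N) \<noteq> I)"

text \<open>Only meaningful for monomial ideals; existence and uniqueness are shown below.\<close>

definition min_gens :: "('n, 'k::field) mpoly set \<Rightarrow> 'n exponents set" where
  "min_gens I = (THE M. is_min_mono_gens M I)"

text \<open>
  In the exchange condition, \<open>Poly_Mapping.lookup v j > 0\<close>, so the truncated subtraction is
  the exact exponent vector of \<open>v/x\<^sub>j\<close>.
\<close>

definition nonpure_dual_exchange :: "('n::finite, 'k::field) mpoly set \<Rightarrow> bool" where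
  "nonpure_dual_exchange I \<longleftrightarrow>
     (\<forall>u\<in>min_gens I. \<forall>v\<in>min_gens I. total_deg u \<le> total_deg v \<longrightarrow>
       (\<forall>i. Poly_Mapping.lookup v i < Poly_Mapping.lookup u i \<longrightarrow>
         (\<exists>j. Poly_Mapping.lookup v j > Poly_Mapping.lookup u j \<and>
              var i * monom (v - Poly_Mapping.single j 1) \<in> I)))"

text \<open>The list positions are counted from 0, so \<open>take i us\<close> lists the generators preceding \<open>us ! i\<close>.\<close>

definition linear_quotients :: "('n, 'k::field) mpoly set \<Rightarrow> bool" where
  "linear_quotients I \<longleftrightarrow>
     (\<exists>us. distinct us \<and> set us = min_gens I \<and>
       (\<forall>i. 1 \<le> i \<and> i < length us \<longrightarrow>
         (\<exists>V. colon_ideal (ideal.span (monom ` set (take i us))) (monom (us ! i)) =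
              (ideal.span (var ` V) :: ('n, 'k) mpoly set))))"

lemma monom_add: "monom (u + v) = monom u * monom v"
  by (simp add: monom_def mult_single)

lemma monom_in_span_iff:
  "(monom u :: ('n, 'k::field) mpoly) \<in> ideal.span (monom ` M) \<longleftrightarrow> (\<exists>m\<in>M. \<exists>d. u = d + m)"
proof
  let ?P = "\<lambda>p :: ('n, 'k) mpoly. \<forall>k\<in>Poly_Mapping.keys p. \<exists>m\<in>M. \<exists>d. k = d + m"
  assume "(monom u :: ('n, 'k) mpoly) \<in> ideal.span (monom ` M)"
  then have "?P (monom u)"
  proof (induction rule: ideal.span_induct_alt)
    case base
    show ?case by simp
  next
    case (step c x y)
    then obtain m where m: "m \<in> M" "x = monom m" by blast
    have "\<exists>d. k = d + m" if "k \<in> Poly_Mapping.keys (c * x)" for k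
      using that keys_mult[of c x] m by (auto simp: monom_def)
    then show ?case
      using step m(1) Poly_Mapping.keys_add[of "c * x" y] by blast
  qed
  then show "\<exists>m\<in>M. \<exists>d. u = d + m" by (simp add: monom_def)
next
  assume "\<exists>m\<in>M. \<exists>d. u = d + m"
  then obtain m d where "m \<in> M" "u = d + m" by blast
  then show "(monom u :: ('n, 'k) mpoly) \<in> ideal.span (monom ` M)"
    by (simp add: monom_add ideal.span_scale ideal.span_base)
qed

lemma min_mono_gens_ex1:
  fixes I :: "('n::finite, 'k::field) mpoly set"
  assumes "monomial_ideal I"
  shows "\<exists>!M. is_min_mono_gens M I"
proof -
  obtain A where A: "I = ideal.span (monom ` A)"
    using assms by (auto simp: monomial_ideal_def)
  define D where "D = {m. monom m \<in> I \<and> (\<forall>d m'. monom m' \<in> I \<longrightarrow> m = d + m' \<longrightarrow> d = 0)}"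
  have below: "\<exists>m\<in>D. \<exists>d. u = d + m" if "monom u \<in> I" for u
    using that
  proof (induction "total_deg u" arbitrary: u rule: less_induct)
    case less
    show ?case
    proof (cases "u \<in> D")
      case True
      then show ?thesis by (metis add_0)
    next
      case False
      then obtain d m where m: "monom m \<in> I" "u = d + m" "d \<noteq> 0"
        using less.prems by (auto simp: D_def)
      obtain i where "Poly_Mapping.lookup d i \<noteq> 0"
        using m(3) by (metis poly_mapping_eqI lookup_zero)
      then have "0 < total_deg d"
        by (auto simp: total_deg_def intro!: sum_pos2)
      then have "total_deg m < total_deg u"
        by (simp add: m(2) total_deg_def lookup_add sum.distrib)
      with less.hyps m show ?thesis by (metis add.assoc)
    qed
  qed
  have genD: "ideal.span (monom ` D) = I"
  proof
    show "ideal.span (monom ` D) \<subseteq> I"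
      unfolding A by (rule ideal.span_minimal) (auto simp: D_def A ideal.subspace_span)
    have "(monom ` A :: ('n, 'k) mpoly set) \<subseteq> ideal.span (monom ` D)"
    proof
      fix p assume "p \<in> (monom ` A :: ('n, 'k) mpoly set)"
      then obtain a where a: "a \<in> A" "p = monom a" by blast
      then have "(monom a :: ('n, 'k) mpoly) \<in> I" by (auto simp: A intro: ideal.span_base)
      from below[OF this] show "p \<in> ideal.span (monom ` D)"
        by (simp add: a(2) monom_in_span_iff)
    qed
    then show "I \<subseteq> ideal.span (monom ` D)"
      unfolding A by (rule ideal.span_minimal) (rule ideal.subspace_span)
  qed
  have sub: "D \<subseteq> M" if M: "ideal.span (monom ` M) = I" for M
  proof
    fix m assume m: "m \<in> D"
    then have "(monom m :: ('n, 'k) mpoly) \<in> ideal.span (monom ` M)" by (simp add: D_def M)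
    then obtain m' d where m': "m' \<in> M" "m = d + m'" by (auto simp: monom_in_span_iff)
    have "(monom m' :: ('n, 'k) mpoly) \<in> I" using m'(1) M by (auto intro: ideal.span_base)
    with m m'(2) have "d = 0" by (auto simp: D_def)
    with m' show "m \<in> M" by simp
  qed
  show ?thesis
  proof (rule ex1I[of _ D])
    show "is_min_mono_gens D I"
      using genD sub unfolding is_min_mono_gens_def by blast
    show "M = D" if "is_min_mono_gens M I" for M
      using that genD sub unfolding is_min_mono_gens_def by blast
  qed
qed

end

theory Submission
  imports Defs
begin

text \<open>
  Everything happens in the finite set \<open>G\<close> of minimal generators, seen as a divisibility antichain of
  exponent vectors. An order of \<open>G\<close> gives linear quotients when for each \<open>u\<close> before \<open>v\<close> some variable
  \<open>x\<^sub>i\<close>, occurring in \<open>u\<close> to a higher power than in \<open>v\<close>, satisfies \<open>w | x\<^sub>i v\<close> for some earlier \<open>w\<close>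
  (\<open>linear_step\<close>); the colon ideal is then generated by these variables
  (\<open>colon_ideal_monom_eq_span_var\<close>).

  Sorting by degree, and lexicographically inside each degree, can fail. The set
  \<open>x\<^sub>1x\<^sub>2, x\<^sub>1x\<^sub>3x\<^sub>4, x\<^sub>2x\<^sub>3x\<^sub>4, x\<^sub>3x\<^sub>4x\<^sub>5\<close> has the exchange property, but if \<open>x\<^sub>5\<close> is the largest variable then
  \<open>x\<^sub>3x\<^sub>4x\<^sub>5\<close> comes directly after \<open>x\<^sub>1x\<^sub>2\<close>, with colon ideal generated by \<open>x\<^sub>1x\<^sub>2\<close>. So the variables
  have to be chosen to suit \<open>G\<close>, and the order is built by splitting \<open>G\<close> with such a variable.

  Let \<open>u\<close> have minimal degree in \<open>G\<close>. If \<open>G\<close> has more than one element, \<open>u\<close> does not divide all of it,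
  so there is a variable \<open>x\<close> whose exponent in \<open>u\<close> exceeds its least exponent \<open>t\<close> in \<open>G\<close>. Let \<open>H\<close>
  consist of the members of \<open>G\<close> with \<open>x\<close>-exponent above \<open>t\<close> and \<open>L\<close> of those with \<open>x\<close>-exponent
  exactly \<open>t\<close>; both are smaller than \<open>G\<close>. Because \<open>u\<close> has minimal degree, it may be exchanged at \<open>x\<close>
  with any \<open>v \<in> L\<close>, and this produces \<open>w \<in> H\<close> with \<open>w | x v\<close>
  (\<open>exchange_raises_min_degree_variable\<close>). Hence, when all of \<open>H\<close> is placed before \<open>L\<close>, the single
  variable \<open>x\<close> accounts for every member of \<open>H\<close> in the colon ideal of \<open>v\<close>. The same fact shows that
  \<open>H\<close> inherits the exchange property; that \<open>L\<close> does is immediate. Induction on the size of \<open>G\<close>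
  finishes the construction, and Dickson's lemma supplies the finiteness of \<open>G\<close>.
\<close>

section \<open>Divisibility of exponent vectors\<close>

definition mdvd :: "'n exponents \<Rightarrow> 'n exponents \<Rightarrow> bool" where
  "mdvd u v \<longleftrightarrow> (\<forall>k. Poly_Mapping.lookup u k \<le> Poly_Mapping.lookup v k)"

lemma mdvd_iff_add: "mdvd u v \<longleftrightarrow> (\<exists>d. v = d + u)"
proof
  assume "mdvd u v"
  then have "v = (v - u) + u"
    by (intro poly_mapping_eqI) (simp add: mdvd_def lookup_add lookup_minus)
  then show "\<exists>d. v = d + u" ..
qed (auto simp: mdvd_def lookup_add)

lemma mdvd_trans: "mdvd u v \<Longrightarrow> mdvd v w \<Longrightarrow> mdvd u w"
  unfolding mdvd_def using order_trans by blast

lemma monom_in_span_iff_mdvd: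
  "(monom u :: ('n, 'k::field) mpoly) \<in> ideal.span (monom ` M) \<longleftrightarrow> (\<exists>m\<in>M. mdvd m u)"
  by (simp add: monom_in_span_iff mdvd_iff_add)

lemma lookup_exchange:
  assumes "i \<noteq> j"
  shows "Poly_Mapping.lookup (Poly_Mapping.single i 1 + (v - Poly_Mapping.single j 1)) k =
    (if k = i then Suc (Poly_Mapping.lookup v k)
     else if k = j then Poly_Mapping.lookup v k - 1 else Poly_Mapping.lookup v k)"
  using assms by (simp add: lookup_add lookup_minus lookup_single when_def)

definition divisor_antichain :: "'n exponents set \<Rightarrow> bool" where
  "divisor_antichain G \<longleftrightarrow> (\<forall>u\<in>G. \<forall>v\<in>G. mdvd u v \<longrightarrow> u = v)"

section \<open>Dickson's lemma\<close>

text \<open>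
  A monotone subsequence exists by a general fact; a decreasing one of natural numbers attains its
  minimum and is constant from there on.
\<close>

lemma nat_seq_mono_subseq:
  fixes s :: "nat \<Rightarrow> nat"
  obtains r :: "nat \<Rightarrow> nat" where "strict_mono r" "mono (\<lambda>n. s (r n))"
proof -
  obtain r :: "nat \<Rightarrow> nat" where r: "strict_mono r" "monoseq (\<lambda>n. s (r n))"
    using seq_monosub by blast
  show thesis
  proof (cases "mono (\<lambda>n. s (r n))")
    case True
    then show thesis using that r by blast
  next
    case False
    then have dec: "s (r n) \<le> s (r m)" if "m \<le> n" for m n
      using r(2) that by (auto simp: monoseq_iff decseq_def)
    \<comment> \<open>\<open>r N\<close> is a position where the decreasing subsequence attains its minimum.\<close>
    obtain N where N: "\<And>n. s (r N) \<le> s (r n)"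
      using ex_has_least_nat[of "\<lambda>_. True" _ "\<lambda>n. s (r n)"] by auto
    have "s (r (n + N)) = s (r N)" for n
      using dec[of N "n + N"] N[of "n + N"] by simp
    then have "mono (\<lambda>n. s (r (n + N)))"
      by (simp add: mono_def)
    moreover have "strict_mono (\<lambda>n. r (n + N))"
      using r(1) by (simp add: strict_mono_def)
    ultimately show thesis using that[of "\<lambda>n. r (n + N)"] by blast
  qed
qed

lemma exponents_mono_subseq:
  fixes f :: "nat \<Rightarrow> 'n exponents"
  assumes "finite A"
  shows "\<exists>r :: nat \<Rightarrow> nat. strict_mono r \<and> (\<forall>i\<in>A. mono (\<lambda>n. Poly_Mapping.lookup (f (r n)) i))"
  using assms
proof (induction A rule: finite_induct)
  case empty
  show ?case using strict_mono_id by auto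
next
  case (insert a A)
  then obtain r :: "nat \<Rightarrow> nat" where r: "strict_mono r"
    "\<And>i. i \<in> A \<Longrightarrow> mono (\<lambda>n. Poly_Mapping.lookup (f (r n)) i)"
    by blast
  obtain q :: "nat \<Rightarrow> nat" where q: "strict_mono q"
    "mono (\<lambda>n. Poly_Mapping.lookup (f (r (q n))) a)"
    using nat_seq_mono_subseq[of "\<lambda>n. Poly_Mapping.lookup (f (r n)) a"] by blast
  have "strict_mono (\<lambda>n. r (q n))"
    using r(1) q(1) by (simp add: strict_mono_def)
  moreover have "mono (\<lambda>n. Poly_Mapping.lookup (f (r (q n))) i)" if "i \<in> A" for i
    using r(2)[OF that] strict_mono_mono[OF q(1)] by (simp add: mono_def)
  ultimately show ?case using q(2) by (intro exI[of _ "\<lambda>n. r (q n)"]) auto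
qed

text \<open>
  Dickson's lemma: along a sequence of distinct members, a subsequence that increases in every
  coordinate would have its first term dividing its second.
\<close>

lemma finite_divisor_antichain:
  fixes G :: "'n::finite exponents set"
  assumes "divisor_antichain G"
  shows "finite G"
proof (rule ccontr)
  assume "infinite G"
  then obtain f :: "nat \<Rightarrow> 'n exponents" where f: "inj f" "range f \<subseteq> G"
    using infinite_countable_subset by blast
  obtain r :: "nat \<Rightarrow> nat" where r: "strict_mono r"
    "\<And>i. mono (\<lambda>n. Poly_Mapping.lookup (f (r n)) i)"
    using exponents_mono_subseq[of UNIV f] by auto
  have "mdvd (f (r 0)) (f (r 1))"
    unfolding mdvd_def using r(2) by (simp add: mono_def)
  then have "f (r 0) = f (r 1)"
    using assms f(2) unfolding divisor_antichain_def by blast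
  then have "r 0 = r 1" using f(1) by (simp add: inj_eq)
  then show False using strict_monoD[OF r(1), of 0 1] by simp
qed

section \<open>Ordering an exchange set\<close>

text \<open>
  The exchange property of the ideal generated by \<open>G\<close>, with membership of a monomial in the ideal
  expressed as divisibility by a member of \<open>G\<close>.
\<close>

definition exchange_set :: "'n::finite exponents set \<Rightarrow> bool" where
  "exchange_set G \<longleftrightarrow>
     (\<forall>u\<in>G. \<forall>v\<in>G. total_deg u \<le> total_deg v \<longrightarrow>
       (\<forall>i. Poly_Mapping.lookup v i < Poly_Mapping.lookup u i \<longrightarrow>
         (\<exists>j. Poly_Mapping.lookup u j < Poly_Mapping.lookup v j \<and>
           (\<exists>w\<in>G. mdvd w (Poly_Mapping.single i 1 + (v - Poly_Mapping.single j 1))))))"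

lemma exchange_setE:
  assumes "exchange_set G" "u \<in> G" "v \<in> G" "total_deg u \<le> total_deg v"
    "Poly_Mapping.lookup v i < Poly_Mapping.lookup u i"
  obtains j w where "Poly_Mapping.lookup u j < Poly_Mapping.lookup v j" "i \<noteq> j" "w \<in> G"
    "mdvd w (Poly_Mapping.single i 1 + (v - Poly_Mapping.single j 1))"
proof -
  obtain j w where "Poly_Mapping.lookup u j < Poly_Mapping.lookup v j" "w \<in> G"
    "mdvd w (Poly_Mapping.single i 1 + (v - Poly_Mapping.single j 1))"
    using assms unfolding exchange_set_def by blast
  moreover from this(1) assms(5) have "i \<noteq> j" by auto
  ultimately show thesis using that by blast
qed

definition linear_step :: "'n exponents set \<Rightarrow> 'n exponents \<Rightarrow> bool" where
  "linear_step A v \<longleftrightarrow>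
     (\<forall>u\<in>A. \<exists>i. Poly_Mapping.lookup v i < Poly_Mapping.lookup u i \<and>
       (\<exists>w\<in>A. mdvd w (Poly_Mapping.single i 1 + v)))"

text \<open>
  Exchanging \<open>u\<close> with \<open>v\<close> at \<open>x\<close> gives \<open>w | x v/x\<^sub>j\<close>. Here \<open>w\<close> cannot divide \<open>v\<close>, and \<open>x\<close> is the only
  variable in which \<open>x v/x\<^sub>j\<close> exceeds \<open>v\<close>; so \<open>w\<close> uses the extra factor \<open>x\<close>. The exact \<open>x\<close>-exponent
  of \<open>w\<close> matters in \<open>exchange_set_upper_part\<close>.
\<close>

lemma exchange_raises_min_degree_variable:
  fixes G :: "'n::finite exponents set"
  assumes G: "exchange_set G" "divisor_antichain G"
    and u: "u \<in> G" "\<And>v. v \<in> G \<Longrightarrow> total_deg u \<le> total_deg v"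
    and v: "v \<in> G" "Poly_Mapping.lookup v x < Poly_Mapping.lookup u x"
  obtains w where "w \<in> G" "mdvd w (Poly_Mapping.single x 1 + v)"
    "Poly_Mapping.lookup w x = Suc (Poly_Mapping.lookup v x)"
proof -
  obtain j w where w: "Poly_Mapping.lookup u j < Poly_Mapping.lookup v j" "x \<noteq> j" "w \<in> G"
    "mdvd w (Poly_Mapping.single x 1 + (v - Poly_Mapping.single j 1))"
    by (rule exchange_setE[OF G(1) u(1) v(1) u(2)[OF v(1)] v(2)])
  have le: "Poly_Mapping.lookup w k \<le> (if k = x then Suc (Poly_Mapping.lookup v k)
     else if k = j then Poly_Mapping.lookup v k - 1 else Poly_Mapping.lookup v k)" for k
    using w(4) unfolding mdvd_def lookup_exchange[OF w(2)] by blast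
  have "w \<noteq> v" using le[of j] w(1,2) by auto
  then have "\<not> mdvd w v"
    using G(2) w(3) v(1) unfolding divisor_antichain_def by blast
  then obtain k where k: "Poly_Mapping.lookup v k < Poly_Mapping.lookup w k"
    by (auto simp: mdvd_def not_le)
  then have "k = x" using le[of k] by (auto split: if_splits)
  then have "Poly_Mapping.lookup w x = Suc (Poly_Mapping.lookup v x)"
    using le[of x] k by simp
  moreover have "mdvd w (Poly_Mapping.single x 1 + v)"
    unfolding mdvd_def
  proof
    fix k show "Poly_Mapping.lookup w k \<le> Poly_Mapping.lookup (Poly_Mapping.single x 1 + v) k"
      using le[of k] by (auto simp: lookup_add lookup_single when_def split: if_splits)
  qed
  ultimately show thesis using that w(3) by blast
qed

text \<open>
  Members of the part agree in their \<open>x\<close>-exponent, so an exchange inside it never raises \<open>x\<close> and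
  the resulting divisor keeps the least \<open>x\<close>-exponent \<open>t\<close>.
\<close>

lemma exchange_set_lower_part:
  fixes G :: "'n::finite exponents set"
  assumes G: "exchange_set G" and t: "\<And>v. v \<in> G \<Longrightarrow> t \<le> Poly_Mapping.lookup v x"
  shows "exchange_set {v \<in> G. Poly_Mapping.lookup v x = t}"
  unfolding exchange_set_def
proof (intro ballI allI impI)
  fix u v i
  assume uv: "u \<in> {v \<in> G. Poly_Mapping.lookup v x = t}" "v \<in> {v \<in> G. Poly_Mapping.lookup v x = t}"
    "total_deg u \<le> total_deg v" and i: "Poly_Mapping.lookup v i < Poly_Mapping.lookup u i"
  then have ix: "i \<noteq> x" by auto
  obtain j w where w: "Poly_Mapping.lookup u j < Poly_Mapping.lookup v j" "i \<noteq> j" "w \<in> G"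
    "mdvd w (Poly_Mapping.single i 1 + (v - Poly_Mapping.single j 1))"
    using uv(1,2) by (auto intro: exchange_setE[OF G _ _ uv(3) i])
  have "Poly_Mapping.lookup w x \<le>
      Poly_Mapping.lookup (Poly_Mapping.single i 1 + (v - Poly_Mapping.single j 1)) x"
    using w(4) unfolding mdvd_def by blast
  then have "Poly_Mapping.lookup w x \<le> t"
    using uv(2) ix unfolding lookup_exchange[OF w(2)] by (auto split: if_splits)
  then have "Poly_Mapping.lookup w x = t" using t[OF w(3)] by simp
  then show "\<exists>j. Poly_Mapping.lookup u j < Poly_Mapping.lookup v j \<and>
      (\<exists>w\<in>{v \<in> G. Poly_Mapping.lookup v x = t}.
        mdvd w (Poly_Mapping.single i 1 + (v - Poly_Mapping.single j 1)))"
    using w by blast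
qed

text \<open>
  The exchange in \<open>G\<close> yields \<open>w\<close> dividing \<open>p = x\<^sub>i v/x\<^sub>j\<close>, but \<open>w\<close> may drop to \<open>x\<close>-exponent \<open>t\<close>. In
  that case raising \<open>w\<close> at \<open>x\<close> gives \<open>w' | x w\<close> with \<open>x\<close>-exponent only \<open>t + 1\<close>. Away from \<open>x\<close> the
  exponents of \<open>w'\<close> are bounded by those of \<open>w\<close>, and at \<open>x\<close> the monomial \<open>p\<close> has exponent at least
  \<open>t + 1\<close>; so \<open>w'\<close> still divides \<open>p\<close>.
\<close>

lemma exchange_set_upper_part:
  fixes G :: "'n::finite exponents set"
  assumes G: "exchange_set G" "divisor_antichain G"
    and t: "\<And>v. v \<in> G \<Longrightarrow> t \<le> Poly_Mapping.lookup v x"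
    and u0: "u0 \<in> G" "\<And>v. v \<in> G \<Longrightarrow> total_deg u0 \<le> total_deg v" "t < Poly_Mapping.lookup u0 x"
  shows "exchange_set {v \<in> G. t < Poly_Mapping.lookup v x}"
  unfolding exchange_set_def
proof (intro ballI allI impI)
  fix u v i
  assume uv: "u \<in> {v \<in> G. t < Poly_Mapping.lookup v x}" "v \<in> {v \<in> G. t < Poly_Mapping.lookup v x}"
    "total_deg u \<le> total_deg v" and i: "Poly_Mapping.lookup v i < Poly_Mapping.lookup u i"
  obtain j w where w: "Poly_Mapping.lookup u j < Poly_Mapping.lookup v j" "i \<noteq> j" "w \<in> G"
    "mdvd w (Poly_Mapping.single i 1 + (v - Poly_Mapping.single j 1))"
    using uv(1,2) by (auto intro: exchange_setE[OF G(1) _ _ uv(3) i])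
  let ?p = "Poly_Mapping.single i 1 + (v - Poly_Mapping.single j 1)"
  have "\<exists>w'\<in>{v \<in> G. t < Poly_Mapping.lookup v x}. mdvd w' ?p"
  proof (cases "t < Poly_Mapping.lookup w x")
    case True
    then show ?thesis using w by blast
  next
    case False
    then have wt: "Poly_Mapping.lookup w x = t" using t[OF w(3)] by simp
    obtain w' where w': "w' \<in> G" "mdvd w' (Poly_Mapping.single x 1 + w)"
      "Poly_Mapping.lookup w' x = Suc t"
      using exchange_raises_min_degree_variable[OF G u0(1,2) w(3), of x] u0(3) unfolding wt by blast
    have px: "Suc t \<le> Poly_Mapping.lookup ?p x"
      \<comment> \<open>If \<open>j = x\<close> then \<open>v\<close> has \<open>x\<close>-exponent above that of \<open>u\<close>, so at least \<open>t + 2\<close>.\<close>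
      using uv(1,2) w(1) unfolding lookup_exchange[OF w(2)] by auto
    have "mdvd w' ?p"
      unfolding mdvd_def
    proof
      fix k show "Poly_Mapping.lookup w' k \<le> Poly_Mapping.lookup ?p k"
      proof (cases "k = x")
        case True
        then show ?thesis using w'(3) px by simp
      next
        case False
        have "Poly_Mapping.lookup w' k \<le> Poly_Mapping.lookup (Poly_Mapping.single x 1 + w) k"
          using w'(2) unfolding mdvd_def by blast
        also have "\<dots> = Poly_Mapping.lookup w k"
          using False by (simp add: lookup_add lookup_single when_def)
        also have "\<dots> \<le> Poly_Mapping.lookup ?p k"
          using w(4) unfolding mdvd_def by blast
        finally show ?thesis .
      qed
    qed
    then show ?thesis using w' by auto
  qed
  then show "\<exists>j. Poly_Mapping.lookup u j < Poly_Mapping.lookup v j \<and>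
      (\<exists>w\<in>{v \<in> G. t < Poly_Mapping.lookup v x}.
        mdvd w (Poly_Mapping.single i 1 + (v - Poly_Mapping.single j 1)))"
    using w(1) by blast
qed

lemma divisor_antichain_subset: "divisor_antichain G \<Longrightarrow> H \<subseteq> G \<Longrightarrow> divisor_antichain H"
  unfolding divisor_antichain_def by blast

lemma exchange_set_linear_order:
  fixes G :: "'n::finite exponents set"
  assumes "finite G" "exchange_set G" "divisor_antichain G"
  shows "\<exists>us. distinct us \<and> set us = G \<and>
    (\<forall>a<length us. linear_step (set (take a us)) (us ! a))"
  using assms
proof (induction "card G" arbitrary: G rule: less_induct)
  case less
  show ?case
  proof (cases "G = {}")
    case True
    then show ?thesis by simp
  next
    case False
    obtain u where u: "u \<in> G" "\<And>v. v \<in> G \<Longrightarrow> total_deg u \<le> total_deg v"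
      using ex_has_least_nat[of "\<lambda>v. v \<in> G" _ total_deg] False by blast
    show ?thesis
    proof (cases "\<forall>v\<in>G. mdvd u v")
      case True
      then have "G = {u}"
        using less.prems(3) u(1) unfolding divisor_antichain_def by blast
      then show ?thesis by (intro exI[of _ "[u]"]) (simp add: linear_step_def)
    next
      case False
      then obtain v0 x where v0: "v0 \<in> G" "Poly_Mapping.lookup v0 x < Poly_Mapping.lookup u x"
        by (auto simp: mdvd_def not_le)
      obtain v1 where v1: "v1 \<in> G" "\<And>v. v \<in> G \<Longrightarrow> Poly_Mapping.lookup v1 x \<le> Poly_Mapping.lookup v x"
        using ex_has_least_nat[of "\<lambda>v. v \<in> G" _ "\<lambda>v. Poly_Mapping.lookup v x"] v0(1) by blast
      define t where "t = Poly_Mapping.lookup v1 x"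
      have t: "t \<le> Poly_Mapping.lookup v x" if "v \<in> G" for v
        using v1(2)[OF that] by (simp add: t_def)
      have ut: "t < Poly_Mapping.lookup u x" using t[OF v0(1)] v0(2) by simp
      define H where "H = {v \<in> G. t < Poly_Mapping.lookup v x}"
      define L where "L = {v \<in> G. Poly_Mapping.lookup v x = t}"
      have "v1 \<notin> H" "u \<notin> L"
        using ut by (auto simp: H_def L_def t_def)
      then have "H \<subset> G" "L \<subset> G"
        using v1(1) u(1) by (auto simp: H_def L_def)
      have HL: "H \<union> L = G" "H \<inter> L = {}"
        using t by (auto simp: H_def L_def le_less)
      have IH: "\<exists>us. distinct us \<and> set us = G' \<and>
          (\<forall>a<length us. linear_step (set (take a us)) (us ! a))"
        if "G' \<subset> G" "exchange_set G'" for G'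
        using that less.prems(1)
        by (intro less.hyps psubset_card_mono divisor_antichain_subset[OF less.prems(3)])
          (auto intro: finite_subset)
      have "exchange_set H"
        unfolding H_def by (rule exchange_set_upper_part[OF less.prems(2,3) t u ut])
      then obtain hs where hs: "distinct hs" "set hs = H"
        "\<And>a. a < length hs \<Longrightarrow> linear_step (set (take a hs)) (hs ! a)"
        using IH[OF \<open>H \<subset> G\<close>] by blast
      have "exchange_set L"
        unfolding L_def by (rule exchange_set_lower_part[OF less.prems(2) t])
      then obtain ls where ls: "distinct ls" "set ls = L"
        "\<And>a. a < length ls \<Longrightarrow> linear_step (set (take a ls)) (ls ! a)"
        using IH[OF \<open>L \<subset> G\<close>] by blast
      \<comment> \<open>Prepending \<open>H\<close> does no harm to an order of \<open>L\<close>: the variable \<open>x\<close> takes care of all of \<open>H\<close>.\<close>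
      have step: "linear_step (H \<union> A) v" if A: "linear_step A v" and v: "v \<in> L" for A v
      proof -
        have vx: "v \<in> G" "Poly_Mapping.lookup v x = t" using v by (auto simp: L_def)
        obtain w where w: "w \<in> G" "mdvd w (Poly_Mapping.single x 1 + v)"
          "Poly_Mapping.lookup w x = Suc t"
          using exchange_raises_min_degree_variable[OF less.prems(2,3) u vx(1), of x] ut
          unfolding vx(2) by blast
        then have "w \<in> H" by (simp add: H_def)
        moreover have "Poly_Mapping.lookup v x < Poly_Mapping.lookup u' x" if "u' \<in> H" for u'
          using that vx(2) by (simp add: H_def)
        ultimately show ?thesis
          using A w(2) unfolding linear_step_def by blast
      qed
      have "linear_step (set (take a (hs @ ls))) ((hs @ ls) ! a)" if a: "a < length (hs @ ls)" for a
      proof (cases "a < length hs")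
        case True
        then show ?thesis using hs(3) by (simp add: nth_append)
      next
        case False
        then have b: "a - length hs < length ls" using a by simp
        then show ?thesis
          using step[OF ls(3)[OF b]] ls(2) nth_mem[OF b] hs(2) False by (simp add: nth_append)
      qed
      then show ?thesis
        using hs(1,2) ls(1,2) HL by (intro exI[of _ "hs @ ls"]) auto
    qed
  qed
qed

section \<open>Colon ideals of monomial ideals\<close>

lemma span_monom_iff_keys:
  fixes p :: "('n, 'k::field) mpoly"
  shows "p \<in> ideal.span (monom ` M) \<longleftrightarrow> (\<forall>k\<in>Poly_Mapping.keys p. \<exists>m\<in>M. mdvd m k)"
proof
  assume "p \<in> ideal.span (monom ` M)"
  then show "\<forall>k\<in>Poly_Mapping.keys p. \<exists>m\<in>M. mdvd m k"
  proof (induction rule: ideal.span_induct_alt)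
    case base
    show ?case by simp
  next
    case (step c x y)
    then obtain m where m: "m \<in> M" "x = monom m" by blast
    have "mdvd m k" if "k \<in> Poly_Mapping.keys (c * x)" for k
      using that keys_mult[of c x] m by (auto simp: monom_def mdvd_iff_add)
    then show ?case
      using step m(1) Poly_Mapping.keys_add[of "c * x" y] by blast
  qed
next
  assume keys: "\<forall>k\<in>Poly_Mapping.keys p. \<exists>m\<in>M. mdvd m k"
  have "Poly_Mapping.single k c \<in> ideal.span (monom ` M)" if "k \<in> Poly_Mapping.keys p" for k and c :: 'k
  proof -
    have "Poly_Mapping.single k c = Poly_Mapping.single 0 c * monom k"
      by (simp add: monom_def mult_single)
    then show ?thesis
      using keys that by (simp add: ideal.span_scale monom_in_span_iff_mdvd)
  qed
  then have "(\<Sum>k\<in>Poly_Mapping.keys p. Poly_Mapping.single k (Poly_Mapping.lookup p k))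
      \<in> ideal.span (monom ` M)"
    by (intro ideal.span_sum) auto
  moreover have "p = (\<Sum>k\<in>Poly_Mapping.keys p. Poly_Mapping.single k (Poly_Mapping.lookup p k))"
    by (rule poly_mapping_eqI)
      (simp add: lookup_sum lookup_single when_def in_keys_iff)
  ultimately show "p \<in> ideal.span (monom ` M)" by simp
qed

lemma lookup_times_monom:
  fixes g :: "('n, 'k::field) mpoly"
  shows "Poly_Mapping.lookup (g * monom v) (k + v) = Poly_Mapping.lookup g k"
proof -
  have "(\<Sum>q. Poly_Mapping.lookup (Poly_Mapping.single v (1::'k)) q when k + v = l + q)
      = (1 when l = k)" for l
  proof -
    have "(Poly_Mapping.lookup (Poly_Mapping.single v (1::'k)) q when k + v = l + q)
        = ((1 when l = k) when q = v)" for q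
      by (auto simp: lookup_single when_def)
    then show ?thesis by simp
  qed
  then show ?thesis by (simp add: monom_def lookup_mult mult_when)
qed

text \<open>
  If \<open>g v\<close> lies in the ideal generated by \<open>A\<close>, then for each monomial \<open>k\<close> of \<open>g\<close> some \<open>m \<in> A\<close>
  divides \<open>k v\<close>. The step condition gives a variable of the colon ideal whose exponent in \<open>m\<close> is
  larger than in \<open>v\<close>; the excess has to come from \<open>k\<close>, which is therefore divisible by that variable.
\<close>

lemma colon_ideal_monom_eq_span_var:
  fixes v :: "'n::finite exponents"
  assumes "linear_step A v"
  shows "colon_ideal (ideal.span (monom ` A)) (monom v) =
    (ideal.span (var ` {i. \<exists>w\<in>A. mdvd w (Poly_Mapping.single i 1 + v)}) :: ('n, 'k::field) mpoly set)"
    (is "?C = ideal.span (var ` ?V)")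
proof
  have var_image: "(var ` ?V :: ('n, 'k) mpoly set) = monom ` ((\<lambda>i. Poly_Mapping.single i 1) ` ?V)"
    by (simp add: var_def image_image)
  show "?C \<subseteq> ideal.span (var ` ?V)"
  proof
    fix g :: "('n, 'k) mpoly" assume "g \<in> ?C"
    then have g: "\<forall>k\<in>Poly_Mapping.keys (g * monom v). \<exists>m\<in>A. mdvd m k"
      by (simp add: colon_ideal_def span_monom_iff_keys)
    have "\<exists>i\<in>?V. mdvd (Poly_Mapping.single i 1) k" if "k \<in> Poly_Mapping.keys g" for k
    proof -
      have "k + v \<in> Poly_Mapping.keys (g * monom v)"
        using that by (simp add: in_keys_iff lookup_times_monom)
      then obtain m where m: "m \<in> A" "mdvd m (k + v)" using g by blast
      obtain i where i: "Poly_Mapping.lookup v i < Poly_Mapping.lookup m i" "i \<in> ?V"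
        using assms m(1) unfolding linear_step_def by blast
      have "Poly_Mapping.lookup m i \<le> Poly_Mapping.lookup k i + Poly_Mapping.lookup v i"
        using m(2) by (simp add: mdvd_def lookup_add)
      then have "mdvd (Poly_Mapping.single i 1) k"
        using i(1) by (auto simp: mdvd_def lookup_single when_def)
      then show ?thesis using i(2) by blast
    qed
    then show "g \<in> ideal.span (var ` ?V)"
      unfolding var_image span_monom_iff_keys by blast
  qed
  show "ideal.span (var ` ?V) \<subseteq> ?C"
  proof (rule ideal.span_minimal)
    show "var ` ?V \<subseteq> ?C"
    proof
      fix p :: "('n, 'k) mpoly" assume "p \<in> var ` ?V"
      then obtain i where "i \<in> ?V" "p = var i" by blast
      moreover from this(2) have "p * monom v = monom (Poly_Mapping.single i 1 + v)"
        by (simp only: var_def monom_add)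
      ultimately show "p \<in> ?C"
        by (simp add: colon_ideal_def monom_in_span_iff_mdvd)
    qed
    show "ideal.subspace ?C"
      unfolding ideal.subspace_def colon_ideal_def mem_Collect_eq distrib_right mult.assoc mult_zero_left
      using ideal.span_zero ideal.span_add ideal.span_scale by blast
  qed
qed

section \<open>From the ideal to its generators\<close>

lemma min_gens_is_min_mono_gens:
  fixes I :: "('n::finite, 'k::field) mpoly set"
  assumes "monomial_ideal I"
  shows "is_min_mono_gens (min_gens I) I"
  unfolding min_gens_def by (rule theI'[OF min_mono_gens_ex1[OF assms]])

text \<open>
  A generator properly divisible by another one could be dropped without changing the ideal.
\<close>

lemma min_mono_gens_divisor_antichain:
  fixes I :: "('n, 'k::field) mpoly set"
  assumes M: "is_min_mono_gens M I"
  shows "divisor_antichain M"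
  unfolding divisor_antichain_def
proof (intro ballI impI, rule ccontr)
  fix u v assume uv: "u \<in> M" "v \<in> M" "mdvd u v" "u \<noteq> v"
  have "(\<exists>m\<in>M - {v}. mdvd m k) \<longleftrightarrow> (\<exists>m\<in>M. mdvd m k)" for k
    using uv mdvd_trans by blast
  then have "ideal.span (monom ` (M - {v})) = (ideal.span (monom ` M) :: ('n, 'k) mpoly set)"
    by (auto simp: span_monom_iff_keys)
  moreover have "M - {v} \<subset> M" using uv(2) by blast
  ultimately show False using M unfolding is_min_mono_gens_def by blast
qed

theorem theorem1p2:
  fixes I :: "('n::finite, 'k::field) mpoly set"
  assumes "monomial_ideal I"
    and "nonpure_dual_exchange I"
  shows "linear_quotients I"
proof -
  let ?G = "min_gens I"
  have M: "is_min_mono_gens ?G I"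
    using assms(1) by (rule min_gens_is_min_mono_gens)
  then have I: "ideal.span (monom ` ?G) = I"
    by (simp add: is_min_mono_gens_def)
  have anti: "divisor_antichain ?G"
    using M by (rule min_mono_gens_divisor_antichain)
  have "var i * monom p \<in> I \<longleftrightarrow> (\<exists>w\<in>?G. mdvd w (Poly_Mapping.single i 1 + p))" for i p
    using monom_in_span_iff_mdvd[of "Poly_Mapping.single i 1 + p" ?G, where ?'k = 'k]
    unfolding I by (simp add: var_def monom_add)
  then have "exchange_set ?G"
    using assms(2) unfolding nonpure_dual_exchange_def exchange_set_def by simp
  then obtain us where us: "distinct us" "set us = ?G"
    "\<And>a. a < length us \<Longrightarrow> linear_step (set (take a us)) (us ! a)"
    using exchange_set_linear_order[OF finite_divisor_antichain[OF anti]] anti by blast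
  show ?thesis
    unfolding linear_quotients_def
  proof (intro exI[of _ us] conjI allI impI)
    fix a assume "1 \<le> a \<and> a < length us"
    then have "a < length us" ..
    then show "\<exists>V. colon_ideal (ideal.span (monom ` set (take a us))) (monom (us ! a)) =
        (ideal.span (var ` V) :: ('n, 'k) mpoly set)"
      using colon_ideal_monom_eq_span_var[OF us(3)] by blast
  qed (use us in auto)
qed

end
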